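(* Let $X,Y$ be countable subsets of $[0,\infty)$, let $S\subset X\times Y$ and assume that the WEP holds for $S$. Then $S$ does not contain any cycle of 2-meshes.
   Context: $S_X,S_Y$ denote the projections of $S$ on $X$ and $Y$. The WEP holds for $S$ if for every $f:S\to\mathbb R$ there exist $\varphi,h:S_X\to\mathbb R$ and $\psi:S_Y\to\mathbb R$ with $f(x,y)=\varphi(x)+h(x)(y-x)-\psi(y)$ for all $(x,y)\in S$. A 2-mesh is a set $\{(x,y),(x,y')\}$ with $x\in X$ and $y\neq y'$ in $Y$; it is identified with the pair consisting of the point $x$ and the two-element set $\{y,y'\}$. A cycle of 2-meshes is a (classical) cycle in the product of $X$ with the set of two-element subsets of $Y$. Explicitly, $S$ contains a cycle of 2-meshes if there are $n\ge2$, distinct points $x_1,\dots,x_n\in X$ and distinct two-element subsets $P_1,\dots,P_n$ of $Y$ such that $\{x_i\}\times P_i\subset S$ and $\{x_{i+1}\}\times P_i\subset S$ for all $1\le i\le n$, with $x_{n+1}=x_1$. *)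

theory Defs
  imports Complex_Main "HOL-Library.Countable_Set"
begin

text \<open>
  Functions on \<open>S\<close>, on the projection \<open>S\<^sub>X = fst ` S\<close> and on \<open>S\<^sub>Y = snd ` S\<close> are rendered as total
  functions of which only the values on these sets are used; every function on a subset is
  the restriction of a total one, so nothing is gained or lost by this.
\<close>

definition WEP :: "(real \<times> real) set \<Rightarrow> bool" where
  "WEP S \<longleftrightarrow>
    (\<forall>f :: real \<times> real \<Rightarrow> real. \<exists>(\<phi> :: real \<Rightarrow> real) (h :: real \<Rightarrow> real) (\<psi> :: real \<Rightarrow> real).
      \<forall>(x, y) \<in> S. f (x, y) = \<phi> x + h x * (y - x) - \<psi> y)"

definition two_subsets :: "'b set \<Rightarrow> 'b set set" where
  "two_subsets Y = {P. P \<subseteq> Y \<and> card P = 2}"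

text \<open>
  The cyclic convention is encoded by a value of \<open>x\<close> at the extra index \<open>Suc n\<close>, which is required
  to be \<open>x 1\<close>; distinctness concerns the indices \<open>1, \<dots>, n\<close> only.
\<close>

definition contains_mesh_cycle :: "'a set \<Rightarrow> 'b set \<Rightarrow> ('a \<times> 'b) set \<Rightarrow> bool" where
  "contains_mesh_cycle X Y S \<longleftrightarrow>
    (\<exists>(n :: nat) (x :: nat \<Rightarrow> 'a) (P :: nat \<Rightarrow> 'b set).
      n \<ge> 2 \<and>
      x ` {1..n} \<subseteq> X \<and> inj_on x {1..n} \<and>
      P ` {1..n} \<subseteq> two_subsets Y \<and> inj_on P {1..n} \<and>
      x (Suc n) = x 1 \<and>
      (\<forall>i \<in> {1..n}. {x i} \<times> P i \<subseteq> S \<and> {x (Suc i)} \<times> P i \<subseteq> S))"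

end

theory Submission
  imports Defs
begin

text \<open>
  Write \<open>P\<^sub>i = {a\<^sub>i, b\<^sub>i}\<close> for the meshes of a cycle. If \<open>f (x, y) = \<phi> x + h x * (y - x) - \<psi> y\<close>, the slope
  of \<open>f (x\<^sub>i, _)\<close> on \<open>P\<^sub>i\<close> minus the slope of \<open>f (x\<^sub>i\<^sub>+\<^sub>1, _)\<close> on \<open>P\<^sub>i\<close> is \<open>h x\<^sub>i - h x\<^sub>i\<^sub>+\<^sub>1\<close>, so these
  differences add up to \<open>0\<close> along the cycle. The indicator function of \<open>(x\<^sub>1, c)\<close> with \<open>c \<in> P\<^sub>1 - P\<^sub>n\<close>
  violates this: only the slope at \<open>x\<^sub>1\<close> on \<open>P\<^sub>1\<close> is nonzero.
\<close>

lemma WEP_mesh_cycle_sum_zero: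
  fixes f :: "real \<times> real \<Rightarrow> real" and x a b :: "nat \<Rightarrow> real"
  assumes "WEP S" and "1 \<le> n" and closed: "x (Suc n) = x 1"
    and ne: "\<And>i. i \<in> {1..n} \<Longrightarrow> a i \<noteq> b i"
    and inS: "\<And>i. i \<in> {1..n} \<Longrightarrow> {x i, x (Suc i)} \<times> {a i, b i} \<subseteq> S"
  shows "(\<Sum>i = 1..n. (f (x i, a i) - f (x i, b i)) / (a i - b i)
           - (f (x (Suc i), a i) - f (x (Suc i), b i)) / (a i - b i)) = 0"
proof -
  obtain \<phi> h \<psi> where f: "\<And>u v. (u, v) \<in> S \<Longrightarrow> f (u, v) = \<phi> u + h u * (v - u) - \<psi> v"
    using \<open>WEP S\<close> unfolding WEP_def by fast
  have "(f (x i, a i) - f (x i, b i)) / (a i - b i)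
          - (f (x (Suc i), a i) - f (x (Suc i), b i)) / (a i - b i) = h (x i) - h (x (Suc i))"
    if i: "i \<in> {1..n}" for i
  proof -
    have "(x i, a i) \<in> S" "(x i, b i) \<in> S" "(x (Suc i), a i) \<in> S" "(x (Suc i), b i) \<in> S"
      using inS[OF i] by auto
    \<comment> \<open>The difference over \<open>{a i, b i}\<close> cancels \<open>\<phi>\<close>;
      comparing the two points then cancels \<open>\<psi>\<close>.\<close>
    then have "(f (x i, a i) - f (x i, b i)) - (f (x (Suc i), a i) - f (x (Suc i), b i))
        = (h (x i) - h (x (Suc i))) * (a i - b i)"
      by (simp add: f algebra_simps)
    then show ?thesis
      using ne[OF i] by (simp add: diff_divide_distrib[symmetric])
  qed
  then have "(\<Sum>i = 1..n. (f (x i, a i) - f (x i, b i)) / (a i - b i)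
           - (f (x (Suc i), a i) - f (x (Suc i), b i)) / (a i - b i))
      = (\<Sum>i = 1..n. h (x i) - h (x (Suc i)))"
    by (rule sum.cong[OF refl])
  also have "\<dots> = - (\<Sum>i = 1..n. h (x (Suc i)) - h (x i))"
    by (simp only: sum_negf[symmetric] minus_diff_eq)
  also have "\<dots> = 0"
    using \<open>1 \<le> n\<close> closed by (subst sum_Suc_diff) auto
  finally show ?thesis .
qed

theorem proposition7p5:
  fixes X Y :: "real set" and S :: "(real \<times> real) set"
  assumes "countable X" and "X \<subseteq> {0..}"
    and "countable Y" and "Y \<subseteq> {0..}"
    and "S \<subseteq> X \<times> Y"
    and "WEP S"
  shows "\<not> contains_mesh_cycle X Y S"
proof
  assume "contains_mesh_cycle X Y S"
  then obtain n x P where n: "n \<ge> 2" and x: "inj_on x {1..n}"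
    and P2: "P ` {1..n} \<subseteq> two_subsets Y" and P: "inj_on P {1..n}"
    and closed: "x (Suc n) = x 1"
    and S: "\<forall>i \<in> {1..n}. {x i} \<times> P i \<subseteq> S \<and> {x (Suc i)} \<times> P i \<subseteq> S"
    unfolding contains_mesh_cycle_def by (elim exE conjE) (rule that)
  have card: "card (P i) = 2" if "i \<in> {1..n}" for i
    using subsetD[OF P2 imageI[OF that]] by (simp add: two_subsets_def)
  then have "\<forall>i. \<exists>a b. i \<in> {1..n} \<longrightarrow> P i = {a, b} \<and> a \<noteq> b"
    by (meson card_2_iff)
  then obtain a b where ab: "\<And>i. i \<in> {1..n} \<Longrightarrow> P i = {a i, b i} \<and> a i \<noteq> b i"
    unfolding choice_iff by blast
  have "P 1 \<noteq> P n"
    using inj_onD[OF P, of 1 n] n by auto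
  \<comment> \<open>Distinct sets of equal finite size are not nested, so \<open>P 1\<close> has an
    element outside \<open>P n\<close>.\<close>
  moreover have "finite (P n)" "card (P 1) = card (P n)"
    using card[of 1] card[of n] n by (auto intro: card_ge_0_finite)
  ultimately obtain c where c: "c \<in> P 1" "c \<notin> P n"
    using card_subset_eq[of "P n" "P 1"] by blast
  define f :: "real \<times> real \<Rightarrow> real" where "f p = (if p = (x 1, c) then 1 else 0)" for p
  let ?D = "\<lambda>i. (f (x i, a i) - f (x i, b i)) / (a i - b i)
           - (f (x (Suc i), a i) - f (x (Suc i), b i)) / (a i - b i)"
  have "(\<Sum>i = 1..n. ?D i) = 0"
    using n S ab by (intro WEP_mesh_cycle_sum_zero[OF \<open>WEP S\<close>]) (auto simp: closed)
  \<comment> \<open>Only at the wrap-around index \<open>i = n\<close> does \<open>x (Suc i)\<close>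
    return to \<open>x 1\<close>; there \<open>c \<notin> P n\<close> makes \<open>f\<close>
    vanish.\<close>
  moreover have shift: "f (x (Suc i), a i) = 0 \<and> f (x (Suc i), b i) = 0" if i: "i \<in> {1..n}" for i
  proof (cases "i = n")
    case True
    then show ?thesis using c ab[OF i] by (auto simp: f_def)
  next
    case False
    then have "x (Suc i) \<noteq> x 1"
      using inj_onD[OF x, of "Suc i" 1] i by auto
    then show ?thesis by (simp add: f_def)
  qed
  have "?D i = 0" if "i \<in> {1..n} - {1}" for i
  proof -
    have "x i \<noteq> x 1"
      using inj_onD[OF x, of i 1] that by auto
    then show ?thesis
      using shift[of i] that by (simp add: f_def)
  qed
  then have "(\<Sum>i = 1..n. ?D i) = (\<Sum>i \<in> {1}. ?D i)"
    using n by (intro sum.mono_neutral_right) auto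
  \<comment> \<open>Exactly one of \<open>a 1\<close> and \<open>b 1\<close> is \<open>c\<close>, so
    the first slope has numerator \<open>1\<close> or \<open>-1\<close>; the second is zero by
    \<open>shift\<close>.\<close>
  moreover have "?D 1 \<noteq> 0"
    using shift[of 1] ab[of 1] c n by (auto simp: f_def)
  ultimately show False
    by simp
qed

end
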